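(* Let $H_1,\dots,H_Q$ be nonzero Hermitian operators on a finite-dimensional Hilbert space, and assume that each individual evolution $e^{-iH_i\tau}$, for any finite time $\tau>0$, can be applied with $O(1)$ gates. Then the evolution under $H=\sum_{i=1}^Q H_i$ for a duration $T$ can be simulated, by applying a random sequence of such individual evolutions, with an error smaller than $\epsilon_0$ using an expected number of gates scaling as $$\bar G=\tilde O\!\left(\frac{c^2T^2}{\epsilon_0}\right),\qquad c=\sum_{i=1}^Q\|H_i\|_\infty .$$
   Context: $\|\cdot\|_\infty$ is the operator norm. "$O(1)$ gates" means at most a fixed constant number $g$ of gates for each evolution, independent of $i$, $\tau$, $Q$, $T$, $\epsilon_0$. Simulation: a (classically sampled) random finite sequence of pairs $(k,\tau)$ is drawn and the unitaries $e^{-iH_k\tau}$ are applied in order; $S_T$ denotes the resulting quantum channel averaged over the randomness, and $\bar G$ the expected total number of gates. The exact channel is $E_T(\sigma)=e^{-iHT}\sigma e^{iHT}$. The error is smaller than $\epsilon_0$ if for every pure input state $\sigma$ the fidelity satisfies $F(E_T(\sigma),S_T(\sigma))\ge1-\epsilon_0$, where $F(|\psi\rangle\langle\psi|,\rho)=\langle\psi|\rho|\psi\rangle$. $\tilde O$ is $O$ up to polylogarithmic factors, with $g$ fixed and with constants independent of $Q$, of the $H_i$ and of $T,\epsilon_0$, in the regime $0<\epsilon_0<1$ and $c^2T^2/\epsilon_0\to\infty$. *)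

theory Defs
  imports "HOL-Probability.Probability" "Jordan_Normal_Form.Schur_Decomposition"
begin

unbundle no vec_syntax

text \<open>
  Operators on an \<open>n\<close>-dimensional Hilbert space are complex matrices in \<^term>\<open>carrier_mat n n\<close>, so
  that bounds can be stated uniformly in the dimension.  The product \<open>v \<bullet>c w\<close> is linear in
  \<open>v\<close> and conjugate-linear in \<open>w\<close>, i.e. it is the bracket \<open>\<langle>w|v\<rangle>\<close>.
\<close>

definition hermitian_op :: "nat \<Rightarrow> complex mat \<Rightarrow> bool" where
  "hermitian_op n A \<longleftrightarrow> A \<in> carrier_mat n n \<and> mat_adjoint A = A"

definition vnorm :: "complex vec \<Rightarrow> real" where
  "vnorm v = sqrt (Re (v \<bullet>c v))"

definition opnorm :: "complex mat \<Rightarrow> real" where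
  "opnorm A = (SUP v \<in> {v \<in> carrier_vec (dim_col A). vnorm v = 1}. vnorm (A *\<^sub>v v))"

definition sum_op :: "nat \<Rightarrow> (nat \<Rightarrow> complex mat) \<Rightarrow> nat set \<Rightarrow> complex mat" where
  "sum_op n H I = mat n n (\<lambda>(a, b). \<Sum>k\<in>I. H k $$ (a, b))"

text \<open>The exponential series of a square matrix; every entry converges absolutely.\<close>

definition mexp :: "complex mat \<Rightarrow> complex mat" where
  "mexp A = mat (dim_row A) (dim_row A) (\<lambda>(a, b). \<Sum>m. (A ^\<^sub>m m) $$ (a, b) / fact m)"

definition evolution :: "complex mat \<Rightarrow> real \<Rightarrow> complex mat" where
  "evolution A t = mexp ((- \<i> * complex_of_real t) \<cdot>\<^sub>m A)"

definition evolution_channel :: "complex mat \<Rightarrow> real \<Rightarrow> complex mat \<Rightarrow> complex mat" where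
  "evolution_channel A t \<sigma> = evolution A t * \<sigma> * evolution A (- t)"

definition pure_state :: "nat \<Rightarrow> complex vec \<Rightarrow> bool" where
  "pure_state n \<psi> \<longleftrightarrow> \<psi> \<in> carrier_vec n \<and> vnorm \<psi> = 1"

definition ket_bra :: "complex vec \<Rightarrow> complex mat" where
  "ket_bra \<psi> = mat (dim_vec \<psi>) (dim_vec \<psi>) (\<lambda>(a, b). \<psi> $ a * cnj (\<psi> $ b))"

text \<open>
  \<open>F(|\<phi>\<rangle>\<langle>\<phi>|, \<rho>) = \<langle>\<phi>|\<rho>|\<phi>\<rangle>\<close>.  The vector \<open>\<phi>\<close> is determined by \<open>|\<phi>\<rangle>\<langle>\<phi>|\<close> only up to a phase;
  the value does not depend on the choice, see \<open>fidelity_ket_bra\<close> below.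
\<close>

definition fidelity :: "complex mat \<Rightarrow> complex mat \<Rightarrow> real" where
  "fidelity \<sigma> \<rho> = (let \<phi> = (SOME \<phi>. \<sigma> = ket_bra \<phi>) in Re ((\<rho> *\<^sub>v \<phi>) \<bullet>c \<phi>))"

lemma bracket_ket_bra:
  assumes "\<rho> \<in> carrier_mat n n" and "\<phi> \<in> carrier_vec n"
  shows "(\<rho> *\<^sub>v \<phi>) \<bullet>c \<phi> = (\<Sum>a<n. \<Sum>b<n. \<rho> $$ (a, b) * ket_bra \<phi> $$ (b, a))"
proof -
  have "(\<rho> *\<^sub>v \<phi>) \<bullet>c \<phi> = (\<Sum>a<n. (\<Sum>b<n. \<rho> $$ (a, b) * \<phi> $ b) * cnj (\<phi> $ a))"
    using assms by (auto simp: scalar_prod_def atLeast0LessThan intro!: sum.cong)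
  also have "\<dots> = (\<Sum>a<n. \<Sum>b<n. \<rho> $$ (a, b) * ket_bra \<phi> $$ (b, a))"
    using assms by (auto simp: ket_bra_def sum_distrib_right mult.assoc intro!: sum.cong)
  finally show ?thesis .
qed

lemma fidelity_ket_bra:
  assumes "\<rho> \<in> carrier_mat n n" and "\<phi> \<in> carrier_vec n"
  shows "fidelity (ket_bra \<phi>) \<rho> = Re ((\<rho> *\<^sub>v \<phi>) \<bullet>c \<phi>)"
proof -
  define \<phi>' where "\<phi>' = (SOME \<phi>'. ket_bra \<phi> = ket_bra \<phi>')"
  have eq: "ket_bra \<phi> = ket_bra \<phi>'"
    unfolding \<phi>'_def by (rule someI[of "\<lambda>\<phi>'. ket_bra \<phi> = ket_bra \<phi>'"]) simp
  have "dim_vec \<phi>' = dim_row (ket_bra \<phi>')"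
    by (simp add: ket_bra_def)
  also have "\<dots> = dim_row (ket_bra \<phi>)"
    by (simp only: eq)
  also have "\<dots> = n"
    using assms(2) by (simp add: ket_bra_def)
  finally have \<phi>': "\<phi>' \<in> carrier_vec n"
    by (rule carrier_vecI)
  have "fidelity (ket_bra \<phi>) \<rho> = Re ((\<rho> *\<^sub>v \<phi>') \<bullet>c \<phi>')"
    unfolding fidelity_def Let_def \<phi>'_def ..
  also have "\<dots> = Re ((\<rho> *\<^sub>v \<phi>) \<bullet>c \<phi>)"
    unfolding bracket_ket_bra[OF assms(1) \<phi>'] bracket_ket_bra[OF assms] eq ..
  finally show ?thesis .
qed

text \<open>The head of the list is applied first.\<close>

definition sequence_channel ::
    "(nat \<Rightarrow> complex mat) \<Rightarrow> (nat \<times> real) list \<Rightarrow> complex mat \<Rightarrow> complex mat" where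
  "sequence_channel H s \<sigma> = fold (\<lambda>(k, \<tau>). evolution_channel (H k) \<tau>) s \<sigma>"

text \<open>
  A random finite sequence of individual evolutions is given by its law \<open>M\<close>.  The \<open>\<sigma>\<close>-algebra of
  \<open>M\<close> is arbitrary (so both discrete and continuous laws of the durations are covered), except
  that it has to make the averaged channel meaningful.
\<close>

definition random_evolutions ::
    "nat \<Rightarrow> nat \<Rightarrow> (nat \<Rightarrow> complex mat) \<Rightarrow> (nat \<times> real) list measure \<Rightarrow> bool" where
  "random_evolutions n Q H M \<longleftrightarrow>
     prob_space M \<and>
     (AE s in M. \<forall>(k, \<tau>)\<in>set s. k \<in> {1..Q} \<and> 0 < \<tau>) \<and>
     (\<forall>\<sigma>\<in>carrier_mat n n. \<forall>a<n. \<forall>b<n. integrable M (\<lambda>s. sequence_channel H s \<sigma> $$ (a, b)))"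

definition averaged_channel ::
    "nat \<Rightarrow> (nat \<Rightarrow> complex mat) \<Rightarrow> (nat \<times> real) list measure \<Rightarrow> complex mat \<Rightarrow> complex mat" where
  "averaged_channel n H M \<sigma> =
     mat n n (\<lambda>(a, b). LINT s|M. sequence_channel H s \<sigma> $$ (a, b))"

definition simulates ::
    "nat \<Rightarrow> nat \<Rightarrow> (nat \<Rightarrow> complex mat) \<Rightarrow> real \<Rightarrow> real \<Rightarrow> (nat \<times> real) list measure \<Rightarrow> bool" where
  "simulates n Q H T \<epsilon>\<^sub>0 M \<longleftrightarrow>
     random_evolutions n Q H M \<and>
     (\<forall>\<psi>. pure_state n \<psi> \<longrightarrow>
        fidelity (evolution_channel (sum_op n H {1..Q}) T (ket_bra \<psi>))
                 (averaged_channel n H M (ket_bra \<psi>)) \<ge> 1 - \<epsilon>\<^sub>0)"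

text \<open>\<open>gates k \<tau>\<close> is the number of gates used to apply the evolution under \<open>H k\<close> for time \<open>\<tau>\<close>.\<close>

definition gate_count :: "(nat \<Rightarrow> real \<Rightarrow> nat) \<Rightarrow> (nat \<times> real) list \<Rightarrow> nat" where
  "gate_count gates s = (\<Sum>(k, \<tau>)\<leftarrow>s. gates k \<tau>)"

definition total_norm :: "nat \<Rightarrow> (nat \<Rightarrow> complex mat) \<Rightarrow> real" where
  "total_norm Q H = (\<Sum>k=1..Q. opnorm (H k))"

end

theory Submission
  imports Defs
begin

text \<open>
  Every step independently draws \<open>k\<close> with probability \<open>\<parallel>H\<^sub>k\<parallel>/c\<close> and applies \<open>exp(-i H\<^sub>k \<tau>\<^sub>k)\<close> with
  \<open>\<tau>\<^sub>k = c T / (N \<parallel>H\<^sub>k\<parallel>)\<close>, so that the mean generator of a step is \<open>H T / N\<close>.  If \<open>V\<close> is the random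
  product, the fidelity is \<open>E |\<langle>U\<psi>|V\<psi>\<rangle>|\<^sup>2 \<ge> 2 Re E \<langle>U\<psi>|V\<psi>\<rangle> - 1\<close> because \<open>|z|\<^sup>2 \<ge> 2 Re z - 1\<close>, and by
  independence \<open>E V = W^N\<close> for the one-step average \<open>W\<close>; hence only operator norms are needed, no
  distances between channels.  With \<open>\<delta> = c T / N\<close>, the first-order terms of \<open>W\<close> and \<open>exp(-i H T / N)\<close>
  agree, so they differ by at most \<open>2 \<delta>\<^sup>2\<close>, and \<open>\<parallel>W^N - U\<parallel> \<le> 2 N \<delta>\<^sup>2 = 2 c\<^sup>2 T\<^sup>2 / N\<close>.  Thus
  \<open>N = \<lceil>4 c\<^sup>2 T\<^sup>2 / \<epsilon>\<^sub>0\<rceil>\<close> steps suffice, without any logarithmic factor.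
\<close>

section \<open>Euclidean norm and inner product of complex vectors\<close>

section \<open>Operator bounds\<close>

text \<open>Connects the norm to \<open>L2_set\<close>, from which the Cauchy-Schwarz and triangle
  inequalities are inherited.\<close>

lemma vnorm_L2_set: "vnorm v = L2_set (\<lambda>i. cmod (v $ i)) {..<dim_vec v}"
  by (simp add: vnorm_def L2_set_def scalar_prod_def atLeast0LessThan complex_mult_cnj cmod_power2)

lemma vnorm_nonneg [simp]: "0 \<le> vnorm v"
  by (simp add: vnorm_L2_set L2_set_nonneg)

lemma cscalar_prod_self: "v \<bullet>c v = complex_of_real ((vnorm v)\<^sup>2)"
proof -
  have "v \<bullet>c v = (\<Sum>i<dim_vec v. complex_of_real ((cmod (v $ i))\<^sup>2))"
    by (auto simp: scalar_prod_def atLeast0LessThan complex_norm_square simp del: of_real_power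
        intro!: sum.cong)
  also have "\<dots> = complex_of_real ((vnorm v)\<^sup>2)"
    by (simp add: vnorm_L2_set L2_set_def sum_nonneg del: of_real_power)
  finally show ?thesis .
qed

lemma cscalar_prod_sum:
  "dim_vec u = n \<Longrightarrow> v \<bullet>c u = (\<Sum>i<n. v $ i * cnj (u $ i))"
  by (auto simp: scalar_prod_def atLeast0LessThan intro!: sum.cong)

lemma cscalar_prod_cauchy_schwarz:
  assumes "v \<in> carrier_vec n" "u \<in> carrier_vec n"
  shows "cmod (v \<bullet>c u) \<le> vnorm v * vnorm u"
proof -
  have "cmod (v \<bullet>c u) \<le> (\<Sum>i<n. \<bar>cmod (v $ i)\<bar> * \<bar>cmod (u $ i)\<bar>)"
    using assms by (auto simp: cscalar_prod_sum[of u n] norm_mult intro!: order.trans[OF norm_sum])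
  also have "\<dots> \<le> vnorm v * vnorm u"
    using L2_set_mult_ineq[of "\<lambda>i. cmod (v $ i)" "\<lambda>i. cmod (u $ i)" "{..<n}"] assms
    by (simp add: vnorm_L2_set)
  finally show ?thesis .
qed

lemma vnorm_triangle:
  assumes "v \<in> carrier_vec n" "u \<in> carrier_vec n"
  shows "vnorm (v + u) \<le> vnorm v + vnorm u"
proof -
  have "vnorm (v + u) \<le> L2_set (\<lambda>i. cmod (v $ i) + cmod (u $ i)) {..<n}"
    using assms by (auto simp: vnorm_L2_set norm_triangle_ineq intro!: L2_set_mono)
  also have "\<dots> \<le> vnorm v + vnorm u"
    using L2_set_triangle_ineq[of "\<lambda>i. cmod (v $ i)" "\<lambda>i. cmod (u $ i)" "{..<n}"] assms
    by (simp add: vnorm_L2_set)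
  finally show ?thesis .
qed

lemma vnorm_smult [simp]: "vnorm (c \<cdot>\<^sub>v v) = cmod c * vnorm v"
  by (auto simp: vnorm_L2_set norm_mult L2_set_right_distrib intro!: L2_set_cong)

lemma vnorm_unit_vec [simp]: "i < n \<Longrightarrow> vnorm (unit_vec n i) = 1"
  by (simp add: vnorm_def)

lemma vnorm_eq_0D: "vnorm v = 0 \<Longrightarrow> v \<in> carrier_vec n \<Longrightarrow> v = 0\<^sub>v n"
  using cscalar_prod_self[of v] by simp

section \<open>Matrix entries, brackets and the calculus of norm bounds\<close>

lemma mult_mat_vec_unit_vec:
  fixes A :: "complex mat"
  assumes "A \<in> carrier_mat n n" "b < n"
  shows "A *\<^sub>v unit_vec n b = col A b"
  using assms by (intro eq_vecI) auto

lemma mat_entry_bracket: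
  fixes A :: "complex mat"
  assumes "A \<in> carrier_mat n n" "a < n" "b < n"
  shows "A $$ (a, b) = (A *\<^sub>v unit_vec n b) \<bullet>c unit_vec n a"
proof -
  have "conjugate (unit_vec n a :: complex vec) = unit_vec n a"
    using assms by (intro eq_vecI) auto
  then show ?thesis
    using assms by (simp add: mult_mat_vec_unit_vec scalar_prod_right_unit[of a n "col A b"])
qed

lemma bracket_sum:
  fixes A :: "complex mat"
  assumes "A \<in> carrier_mat n n" "v \<in> carrier_vec n" "u \<in> carrier_vec n"
  shows "(A *\<^sub>v v) \<bullet>c u = (\<Sum>a<n. \<Sum>b<n. A $$ (a, b) * (v $ b * cnj (u $ a)))"
  using assms
  by (auto simp: cscalar_prod_sum[of u n] scalar_prod_def atLeast0LessThan sum_distrib_right mult.assoc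
      intro!: sum.cong)

text \<open>A bound on the operator norm as a relation: bounds then compose through rules for sums,
  products and powers, without handling the supremum in \<open>opnorm\<close>, which ranges over the
  empty set when n = 0.\<close>

definition op_bound :: "nat \<Rightarrow> real \<Rightarrow> complex mat \<Rightarrow> bool" where
  "op_bound n K A \<longleftrightarrow>
     A \<in> carrier_mat n n \<and> (\<forall>v\<in>carrier_vec n. vnorm (A *\<^sub>v v) \<le> K * vnorm v)"

lemma op_bound_carrier [dest]: "op_bound n K A \<Longrightarrow> A \<in> carrier_mat n n"
  by (simp add: op_bound_def)

lemma op_boundD: "op_bound n K A \<Longrightarrow> v \<in> carrier_vec n \<Longrightarrow> vnorm (A *\<^sub>v v) \<le> K * vnorm v"
  by (simp add: op_bound_def)

lemma op_bound_bracket: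
  assumes "op_bound n K A" "v \<in> carrier_vec n" "u \<in> carrier_vec n"
  shows "cmod ((A *\<^sub>v v) \<bullet>c u) \<le> K * vnorm v * vnorm u"
proof -
  have "cmod ((A *\<^sub>v v) \<bullet>c u) \<le> vnorm (A *\<^sub>v v) * vnorm u"
    using assms by (intro cscalar_prod_cauchy_schwarz[of _ n]) auto
  also have "\<dots> \<le> K * vnorm v * vnorm u"
    using assms by (intro mult_right_mono op_boundD) auto
  finally show ?thesis .
qed

text \<open>The choice u = A v gives |Av|^2 \<le> K |v| |Av|, and one factor cancels. This form
  suits matrices given by entrywise sums or series, whose brackets are explicit scalars.\<close>

lemma op_boundI_bracket:
  assumes "A \<in> carrier_mat n n"
    and "\<And>v u. v \<in> carrier_vec n \<Longrightarrow> u \<in> carrier_vec n \<Longrightarrow>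
      cmod ((A *\<^sub>v v) \<bullet>c u) \<le> K * vnorm v * vnorm u"
  shows "op_bound n K A"
  unfolding op_bound_def
proof (intro conjI ballI)
  fix v :: "complex vec" assume v: "v \<in> carrier_vec n"
  have Av: "A *\<^sub>v v \<in> carrier_vec n" using assms v by auto
  have "vnorm (A *\<^sub>v v) * vnorm (A *\<^sub>v v) \<le> (K * vnorm v) * vnorm (A *\<^sub>v v)"
    using assms(2)[OF v Av] by (simp add: cscalar_prod_self norm_mult power2_eq_square)
  \<comment> \<open>When A v vanishes nothing can be cancelled and the goal becomes
    \<open>0 \<le> K * vnorm v\<close>; the choice u = v yields it.\<close>
  moreover have "0 \<le> K * vnorm v" if "vnorm (A *\<^sub>v v) = 0"
  proof (cases "v = 0\<^sub>v n")
    case False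
    then have "0 < vnorm v" using vnorm_eq_0D[OF _ v] vnorm_nonneg[of v] by linarith
    have "0 \<le> K * vnorm v * vnorm v"
      using assms(2)[OF v v] norm_ge_zero order_trans by blast
    then show ?thesis
      using \<open>0 < vnorm v\<close> by (simp add: zero_le_mult_iff)
  qed (simp add: vnorm_L2_set L2_set_def)
  ultimately show "vnorm (A *\<^sub>v v) \<le> K * vnorm v"
    using vnorm_nonneg[of "A *\<^sub>v v"] by (metis less_eq_real_def mult_le_cancel_right_pos)
qed (fact assms(1))

lemma op_bound_entry:
  assumes "op_bound n K A" "a < n" "b < n"
  shows "cmod (A $$ (a, b)) \<le> K"
  using op_bound_bracket[OF assms(1), of "unit_vec n b" "unit_vec n a"] assms
  by (simp add: mat_entry_bracket[OF op_bound_carrier[OF assms(1)] assms(2,3)])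

lemma op_bound_add:
  assumes "op_bound n K A" "op_bound n L B"
  shows "op_bound n (K + L) (A + B)"
  unfolding op_bound_def
proof (intro conjI ballI)
  fix v :: "complex vec" assume v: "v \<in> carrier_vec n"
  have "vnorm ((A + B) *\<^sub>v v) \<le> vnorm (A *\<^sub>v v) + vnorm (B *\<^sub>v v)"
    using assms[THEN op_bound_carrier] v
    by (auto simp: add_mult_distrib_mat_vec[of _ n n] intro!: vnorm_triangle[of _ n])
  also have "\<dots> \<le> (K + L) * vnorm v"
    using op_boundD[OF assms(1) v] op_boundD[OF assms(2) v] by (simp add: algebra_simps)
  finally show "vnorm ((A + B) *\<^sub>v v) \<le> (K + L) * vnorm v" .
qed (use assms in auto)

lemma op_bound_smult:
  assumes "op_bound n K A"
  shows "op_bound n (cmod c * K) (c \<cdot>\<^sub>m A)"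
  unfolding op_bound_def
proof (intro conjI ballI)
  fix v :: "complex vec" assume v: "v \<in> carrier_vec n"
  have A: "A \<in> carrier_mat n n" using assms by auto
  have "(c \<cdot>\<^sub>m A) *\<^sub>v v = c \<cdot>\<^sub>v (A *\<^sub>v v)"
    using A v by (intro eq_vecI) (auto simp: scalar_prod_def sum_distrib_left mult.assoc)
  then show "vnorm ((c \<cdot>\<^sub>m A) *\<^sub>v v) \<le> cmod c * K * vnorm v"
    using op_boundD[OF assms v] by (simp add: mult_left_mono mult.assoc)
qed (use assms in auto)

lemma op_bound_diff:
  assumes "op_bound n K A" "op_bound n L B"
  shows "op_bound n (K + L) (A - B)"
proof -
  have "A - B = A + (-1) \<cdot>\<^sub>m B"
    using assms[THEN op_bound_carrier] by (intro eq_matI) auto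
  then show ?thesis
    using op_bound_add[OF assms(1) op_bound_smult[OF assms(2), of "-1"]] by simp
qed

lemma op_bound_mult:
  assumes "op_bound n K A" "op_bound n L B" "0 \<le> K"
  shows "op_bound n (K * L) (A * B)"
  unfolding op_bound_def
proof (intro conjI ballI)
  fix v :: "complex vec" assume v: "v \<in> carrier_vec n"
  have "vnorm ((A * B) *\<^sub>v v) = vnorm (A *\<^sub>v (B *\<^sub>v v))"
    using assms v by (subst assoc_mult_mat_vec[of _ n n _ n]) auto
  also have "\<dots> \<le> K * vnorm (B *\<^sub>v v)"
    using assms v by (intro op_boundD) auto
  also have "\<dots> \<le> K * (L * vnorm v)"
    using assms v by (intro mult_left_mono op_boundD) auto
  finally show "vnorm ((A * B) *\<^sub>v v) \<le> K * L * vnorm v" by (simp add: mult.assoc)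
qed (use assms(1,2)[THEN op_bound_carrier] in auto)

lemma op_bound_one [simp]: "op_bound n 1 (1\<^sub>m n)"
  by (simp add: op_bound_def)

lemma op_bound_pow:
  assumes "op_bound n K A" "0 \<le> K"
  shows "op_bound n (K ^ m) (A ^\<^sub>m m)"
proof (induction m)
  case 0
  then show ?case using op_bound_carrier[OF assms(1)] by simp
next
  case (Suc m)
  then show ?case
    using op_bound_mult[OF Suc assms(1)] assms(2) by (simp add: mult.commute)
qed

lemma sum_op_insert:
  assumes "finite I" "k \<notin> I" "A k \<in> carrier_mat n n"
  shows "sum_op n A (insert k I) = A k + sum_op n A I"
  using assms by (intro eq_matI) (auto simp: sum_op_def)

lemma op_bound_sum_op:
  assumes "finite I" "\<And>k. k \<in> I \<Longrightarrow> op_bound n (K k) (A k)"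
  shows "op_bound n (\<Sum>k\<in>I. K k) (sum_op n A I)"
  using assms
proof (induction I rule: finite_induct)
  case empty
  have "op_bound n 0 (sum_op n A {})"
    by (rule op_boundI_bracket) (auto simp: sum_op_def bracket_sum[of _ n])
  then show ?case by simp
next
  case (insert k I)
  have "op_bound n (K k + sum K I) (A k + sum_op n A I)"
    using insert.IH insert.prems by (intro op_bound_add) auto
  then show ?case
    using insert.hyps insert.prems[of k] by (simp add: sum_op_insert op_bound_carrier)
qed

text \<open>A crude bound for places where only finiteness matters: the supremum in
  \<open>opnorm\<close>, and the domination of the exponential series.\<close>

lemma op_bound_sum_norm_entries:
  assumes A: "A \<in> carrier_mat n n"
  shows "op_bound n (\<Sum>a<n. \<Sum>b<n. cmod (A $$ (a, b))) A"
proof (rule op_boundI_bracket[OF A])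
  fix v u :: "complex vec" assume v: "v \<in> carrier_vec n" and u: "u \<in> carrier_vec n"
  have le: "cmod (w $ i) \<le> vnorm w" if "w \<in> carrier_vec n" "i < n" for w i
    unfolding vnorm_L2_set using that by (intro member_le_L2_set) auto
  have "cmod ((A *\<^sub>v v) \<bullet>c u) \<le> (\<Sum>a<n. \<Sum>b<n. cmod (A $$ (a, b)) * (cmod (v $ b) * cmod (u $ a)))"
    unfolding bracket_sum[OF A v u]
    by (intro order.trans[OF norm_sum] sum_mono) (simp add: norm_mult)
  also have "\<dots> \<le> (\<Sum>a<n. \<Sum>b<n. cmod (A $$ (a, b)) * (vnorm v * vnorm u))"
    using v u by (intro sum_mono mult_left_mono mult_mono le) auto
  finally show "cmod ((A *\<^sub>v v) \<bullet>c u) \<le> (\<Sum>a<n. \<Sum>b<n. cmod (A $$ (a, b))) * vnorm v * vnorm u"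
    by (simp add: sum_distrib_right mult.assoc)
qed

section \<open>The supremum norm as a norm bound\<close>

lemma vnorm_le_opnorm:
  assumes A: "A \<in> carrier_mat n n" and v: "v \<in> carrier_vec n" "vnorm v = 1"
  shows "vnorm (A *\<^sub>v v) \<le> opnorm A"
  unfolding opnorm_def
proof (rule cSUP_upper)
  \<comment> \<open>The supremum is taken in the conditionally complete reals, so it is an upper
    bound only once the set is known to be bounded.\<close>
  show "bdd_above ((\<lambda>v. vnorm (A *\<^sub>v v)) ` {v \<in> carrier_vec (dim_col A). vnorm v = 1})"
  proof (rule bdd_aboveI2)
    fix w assume "w \<in> {v \<in> carrier_vec (dim_col A). vnorm v = 1}"
    then show "vnorm (A *\<^sub>v w) \<le> (\<Sum>a<n. \<Sum>b<n. cmod (A $$ (a, b)))"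
      using op_boundD[OF op_bound_sum_norm_entries[OF A], of w] A by auto
  qed
qed (use assms in auto)

text \<open>Normalising v reduces to unit vectors; for a vector of norm zero the crude entry bound
  gives A v norm zero as well.\<close>

lemma op_bound_opnorm:
  assumes A: "A \<in> carrier_mat n n"
  shows "op_bound n (opnorm A) A"
  unfolding op_bound_def
proof (intro conjI ballI)
  fix v :: "complex vec" assume v: "v \<in> carrier_vec n"
  show "vnorm (A *\<^sub>v v) \<le> opnorm A * vnorm v"
  proof (cases "vnorm v = 0")
    case True
    then show ?thesis
      using op_boundD[OF op_bound_sum_norm_entries[OF A] v] by simp
  next
    case False
    define w where "w = complex_of_real (1 / vnorm v) \<cdot>\<^sub>v v"
    have w: "w \<in> carrier_vec n" "vnorm w = 1"
      using v False by (auto simp: w_def norm_divide)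
    have "A *\<^sub>v w = complex_of_real (1 / vnorm v) \<cdot>\<^sub>v (A *\<^sub>v v)"
      using A v unfolding w_def by (rule mult_mat_vec)
    then have "vnorm (A *\<^sub>v v) / vnorm v \<le> opnorm A"
      using vnorm_le_opnorm[OF A w] by (simp add: norm_divide)
    then show ?thesis
      using False vnorm_nonneg[of v] by (simp add: divide_le_eq)
  qed
qed (fact A)

text \<open>Any nonzero entry is a matrix element between unit vectors and bounds the norm from
  below. Positivity allows the durations of the protocol to be divided by
  \<open>opnorm (H k)\<close>.\<close>

lemma opnorm_pos:
  assumes A: "A \<in> carrier_mat n n" and "A \<noteq> 0\<^sub>m n n"
  shows "0 < opnorm A"
proof -
  obtain a b where ab: "a < n" "b < n" "A $$ (a, b) \<noteq> 0"
    using assms by (metis carrier_matD eq_matI index_zero_mat(1,2,3))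
  then have "0 < cmod (A $$ (a, b))" by simp
  then show ?thesis
    using op_bound_entry[OF op_bound_opnorm[OF A] ab(1,2)] by linarith
qed

section \<open>Convergence of the exponential series and its group law\<close>

section \<open>The matrix exponential\<close>

lemma smult_pow_mat:
  fixes A :: "complex mat"
  assumes A: "A \<in> carrier_mat n n"
  shows "(c \<cdot>\<^sub>m A) ^\<^sub>m m = c ^ m \<cdot>\<^sub>m (A ^\<^sub>m m)"
proof (induction m)
  case 0
  show ?case by (intro eq_matI) auto
next
  case (Suc m)
  have "(c ^ m \<cdot>\<^sub>m (A ^\<^sub>m m)) * (c \<cdot>\<^sub>m A) = c ^ Suc m \<cdot>\<^sub>m (A ^\<^sub>m m * A)"
    using A by (intro eq_matI) (auto simp: scalar_prod_def sum_distrib_left ac_simps intro!: sum.cong)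
  then show ?case by (simp add: Suc)
qed

lemma pow_mat_add:
  fixes A :: "complex mat"
  assumes A: "A \<in> carrier_mat n n"
  shows "A ^\<^sub>m (i + j) = A ^\<^sub>m i * A ^\<^sub>m j"
proof (induction j)
  case 0
  show ?case using A pow_carrier_mat[OF A, of i] by simp
next
  case (Suc j)
  then show ?case
    using A pow_carrier_mat[OF A] by (simp add: assoc_mult_mat[of _ n n _ n _ n])
qed

lemma mat_entry_mult:
  assumes "A \<in> carrier_mat n n" "B \<in> carrier_mat n n" "a < n" "b < n"
  shows "(A * B) $$ (a, b) = (\<Sum>c<n. A $$ (a, c) * B $$ (c, b))"
  using assms by (auto simp: scalar_prod_def atLeast0LessThan intro!: sum.cong)

lemma mexp_carrier [simp]: "A \<in> carrier_mat n n \<Longrightarrow> mexp A \<in> carrier_mat n n"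
  by (auto simp: mexp_def)

lemma summable_norm_mexp_entry:
  fixes A :: "complex mat"
  assumes A: "A \<in> carrier_mat n n" and ab: "a < n" "b < n"
  shows "summable (\<lambda>m. norm ((A ^\<^sub>m m) $$ (a, b) / fact m))"
proof (rule summable_comparison_test)
  define K where "K = (\<Sum>a<n. \<Sum>b<n. cmod (A $$ (a, b)))"
  have K: "op_bound n K A" "0 \<le> K"
    using op_bound_sum_norm_entries[OF A] by (auto simp: K_def intro!: sum_nonneg)
  show "\<exists>N. \<forall>m\<ge>N. norm (norm ((A ^\<^sub>m m) $$ (a, b) / fact m)) \<le> inverse (fact m) * K ^ m"
    using op_bound_entry[OF op_bound_pow[OF K] ab] by (auto simp: norm_divide divide_simps)
  show "summable (\<lambda>m. inverse (fact m) * K ^ m)"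
    by (rule summable_exp)
qed

lemma mexp_entry_sums:
  assumes A: "A \<in> carrier_mat n n" and ab: "a < n" "b < n"
  shows "(\<lambda>m. (A ^\<^sub>m m) $$ (a, b) / fact m) sums (mexp A $$ (a, b))"
  using summable_sums[OF summable_norm_cancel[OF summable_norm_mexp_entry[OF assms]]] assms
  by (simp add: mexp_def)

text \<open>In finite dimension a bracket is a finite linear combination of entries, so entrywise
  convergence is enough.\<close>

lemma mexp_bracket_sums:
  assumes A: "A \<in> carrier_mat n n" and v: "v \<in> carrier_vec n" and u: "u \<in> carrier_vec n"
  shows "(\<lambda>m. ((A ^\<^sub>m m *\<^sub>v v) \<bullet>c u) / fact m) sums ((mexp A *\<^sub>v v) \<bullet>c u)"
proof -
  have "(\<lambda>m. \<Sum>a<n. \<Sum>b<n. (A ^\<^sub>m m) $$ (a, b) / fact m * (v $ b * cnj (u $ a))) sums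
      (\<Sum>a<n. \<Sum>b<n. mexp A $$ (a, b) * (v $ b * cnj (u $ a)))"
    by (intro sums_sum sums_mult2 mexp_entry_sums[OF A]) auto
  then show ?thesis
    by (simp add: bracket_sum[OF pow_carrier_mat[OF A] v u] bracket_sum[OF mexp_carrier[OF A] v u]
        sum_divide_distrib)
qed

text \<open>Both series converge absolutely in each entry, so their product is the Cauchy product.
  All matrix factors are powers of X and merge to \<open>X ^\<^sub>m k\<close>, which leaves the
  scalar law for the coefficients.\<close>

lemma mexp_smult_add:
  assumes X: "X \<in> carrier_mat n n"
  shows "mexp (s \<cdot>\<^sub>m X) * mexp (t \<cdot>\<^sub>m X) = mexp ((s + t) \<cdot>\<^sub>m X)"
proof (rule eq_matI)
  fix a b assume "a < dim_row (mexp ((s + t) \<cdot>\<^sub>m X))" "b < dim_col (mexp ((s + t) \<cdot>\<^sub>m X))"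
  then have ab: "a < n" "b < n" using X by (auto simp: mexp_def)
  \<comment> \<open>The coefficient of the scalar exponential series, written with
    \<open>/\<^sub>R\<close> to fit \<open>exp_series_add_commuting\<close>.\<close>
  let ?S = "\<lambda>x k. x ^ k /\<^sub>R fact k :: complex"
  have entry: "((x \<cdot>\<^sub>m X) ^\<^sub>m m) $$ (i, j) / fact m = ?S x m * (X ^\<^sub>m m) $$ (i, j)"
    if "i < n" "j < n" for x m i j
    using that X by (simp add: smult_pow_mat[OF X] pow_mat_dim scaleR_conv_of_real field_simps)
  have pow: "(\<Sum>c<n. (X ^\<^sub>m i) $$ (a, c) * (X ^\<^sub>m (k - i)) $$ (c, b)) = (X ^\<^sub>m k) $$ (a, b)"
    if "i \<le> k" for i k
    using pow_mat_add[OF X, of i "k - i"] that ab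
    by (simp flip: mat_entry_mult[OF pow_carrier_mat[OF X] pow_carrier_mat[OF X]])
  have "(\<lambda>k. \<Sum>c<n. \<Sum>i\<le>k. ((s \<cdot>\<^sub>m X) ^\<^sub>m i) $$ (a, c) / fact i *
          (((t \<cdot>\<^sub>m X) ^\<^sub>m (k - i)) $$ (c, b) / fact (k - i)))
        sums (\<Sum>c<n. (\<Sum>m. ((s \<cdot>\<^sub>m X) ^\<^sub>m m) $$ (a, c) / fact m) *
          (\<Sum>m. ((t \<cdot>\<^sub>m X) ^\<^sub>m m) $$ (c, b) / fact m))"
    using X ab by (intro sums_sum Cauchy_product_sums summable_norm_mexp_entry[of _ n]) auto
  also have "(\<lambda>k. \<Sum>c<n. \<Sum>i\<le>k. ((s \<cdot>\<^sub>m X) ^\<^sub>m i) $$ (a, c) / fact i *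
          (((t \<cdot>\<^sub>m X) ^\<^sub>m (k - i)) $$ (c, b) / fact (k - i))) =
      (\<lambda>k. (((s + t) \<cdot>\<^sub>m X) ^\<^sub>m k) $$ (a, b) / fact k)"
  proof
    fix k
    have "(\<Sum>c<n. \<Sum>i\<le>k. ((s \<cdot>\<^sub>m X) ^\<^sub>m i) $$ (a, c) / fact i *
          (((t \<cdot>\<^sub>m X) ^\<^sub>m (k - i)) $$ (c, b) / fact (k - i))) =
        (\<Sum>i\<le>k. \<Sum>c<n. (?S s i * (X ^\<^sub>m i) $$ (a, c)) * (?S t (k - i) * (X ^\<^sub>m (k - i)) $$ (c, b)))"
      using ab by (subst sum.swap) (simp add: entry)
    also have "\<dots> = (\<Sum>i\<le>k. ?S s i * ?S t (k - i) *
        (\<Sum>c<n. (X ^\<^sub>m i) $$ (a, c) * (X ^\<^sub>m (k - i)) $$ (c, b)))"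
      by (simp add: sum_distrib_left mult_ac)
    also have "\<dots> = (\<Sum>i\<le>k. ?S s i * ?S t (k - i)) * (X ^\<^sub>m k) $$ (a, b)"
      unfolding sum_distrib_right by (intro sum.cong) (simp_all add: pow)
    \<comment> \<open>This is the binomial theorem divided by k!.\<close>
    also have "\<dots> = ?S (s + t) k * (X ^\<^sub>m k) $$ (a, b)"
      by (simp add: exp_series_add_commuting mult.commute)
    finally show "(\<Sum>c<n. \<Sum>i\<le>k. ((s \<cdot>\<^sub>m X) ^\<^sub>m i) $$ (a, c) / fact i *
          (((t \<cdot>\<^sub>m X) ^\<^sub>m (k - i)) $$ (c, b) / fact (k - i))) =
        (((s + t) \<cdot>\<^sub>m X) ^\<^sub>m k) $$ (a, b) / fact k"
      by (simp add: entry[OF ab])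
  qed
  finally have "(\<Sum>c<n. mexp (s \<cdot>\<^sub>m X) $$ (a, c) * mexp (t \<cdot>\<^sub>m X) $$ (c, b)) = mexp ((s + t) \<cdot>\<^sub>m X) $$ (a, b)"
    using X ab by (simp add: mexp_def sums_iff)
  then show "(mexp (s \<cdot>\<^sub>m X) * mexp (t \<cdot>\<^sub>m X)) $$ (a, b) = mexp ((s + t) \<cdot>\<^sub>m X) $$ (a, b)"
    using X ab by (simp add: mat_entry_mult[of _ n] del: index_mult_mat)
qed (use X in \<open>auto simp: mexp_def\<close>)

lemma mexp_smult_zero:
  assumes X: "X \<in> carrier_mat n n"
  shows "mexp (0 \<cdot>\<^sub>m X) = 1\<^sub>m n"
proof (rule eq_matI)
  fix a b assume ab: "a < dim_row (1\<^sub>m n :: complex mat)" "b < dim_col (1\<^sub>m n :: complex mat)"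
  have "mexp (0 \<cdot>\<^sub>m X) $$ (a, b) = (\<Sum>m. (X ^\<^sub>m m) $$ (a, b) / fact m * 0 ^ m)"
    using X ab by (simp add: mexp_def smult_pow_mat[OF X] pow_mat_dim mult.commute)
  also have "\<dots> = (1\<^sub>m n) $$ (a, b)"
    using X by (subst powser_zero) simp
  finally show "mexp (0 \<cdot>\<^sub>m X) $$ (a, b) = 1\<^sub>m n $$ (a, b)" .
qed (use X in \<open>auto simp: mexp_def\<close>)

section \<open>First-order remainders of exponentials and their accumulation over many steps\<close>

lemma op_bound_mexp_remainder:
  assumes A: "op_bound n K A" and K: "0 \<le> K" "K \<le> 1"
  shows "op_bound n (K\<^sup>2) (mexp A - (1\<^sub>m n + A))"
proof (rule op_boundI_bracket)
  have Ac [simp]: "A \<in> carrier_mat n n" using A by auto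
  then show "mexp A - (1\<^sub>m n + A) \<in> carrier_mat n n" by (intro minus_carrier_mat) auto
  fix v u :: "complex vec" assume vu [simp]: "v \<in> carrier_vec n" "u \<in> carrier_vec n"
  let ?f = "\<lambda>m. ((A ^\<^sub>m m *\<^sub>v v) \<bullet>c u) / fact m"
  \<comment> \<open>The brackets are dominated term by term by the scalar exponential series of K,
    so the tail after two terms is at most exp K - 1 - K.\<close>
  let ?g = "\<lambda>m. K ^ m /\<^sub>R fact m * (vnorm v * vnorm u)"
  have 2: "(\<Sum>m<2. h m) = h 0 + h 1" for h :: "nat \<Rightarrow> 'a :: comm_monoid_add"
    by (simp add: numeral_2_eq_2)
  have bound: "norm (?f m) \<le> ?g m" for m
    using op_bound_bracket[OF op_bound_pow[OF A K(1), of m] vu]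
    by (simp add: norm_divide divide_simps mult.assoc)
  have f: "?f sums ((mexp A *\<^sub>v v) \<bullet>c u)" by (rule mexp_bracket_sums[of A n]) auto
  have g: "?g sums (exp K * (vnorm v * vnorm u))"
    by (intro sums_mult2 exp_converges)
  \<comment> \<open>The terms split off are the brackets of the identity and of A.\<close>
  have f2: "(\<lambda>m. ?f (m + 2)) sums ((mexp A *\<^sub>v v) \<bullet>c u - (?f 0 + ?f 1))"
    using f by (subst sums_iff_shift) (simp add: 2)
  have g2: "(\<lambda>m. ?g (m + 2)) sums (exp K * (vnorm v * vnorm u) - (?g 0 + ?g 1))"
    using g by (subst sums_iff_shift) (simp add: 2)
  have "((mexp A - (1\<^sub>m n + A)) *\<^sub>v v) \<bullet>c u = (mexp A *\<^sub>v v) \<bullet>c u - (?f 0 + ?f 1)"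
    using carrier_matD(1)[OF Ac] mult_mat_vec_carrier[OF Ac vu(1)]
      mult_mat_vec_carrier[OF mexp_carrier[OF Ac] vu(1)]
    by (simp add: minus_mult_distrib_mat_vec[of _ n n] add_mult_distrib_mat_vec[of _ n n]
        minus_scalar_prod_distrib[of _ n] add_scalar_prod_distrib[of _ n])
  then have "cmod (((mexp A - (1\<^sub>m n + A)) *\<^sub>v v) \<bullet>c u) = norm (\<Sum>m. ?f (m + 2))"
    using sums_unique[OF f2] by simp
  also have "\<dots> \<le> (\<Sum>m. ?g (m + 2))"
    using bound by (intro norm_suminf_le sums_summable[OF g2])
  also have "\<dots> = (exp K - (1 + K)) * (vnorm v * vnorm u)"
    using sums_unique[OF g2] by (simp add: algebra_simps)
  \<comment> \<open>Here K \<le> 1 enters: on the unit interval exp K \<le> 1 + K + K^2.\<close>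
  also have "\<dots> \<le> K\<^sup>2 * (vnorm v * vnorm u)"
    using exp_bound[OF K] by (intro mult_right_mono) auto
  finally show "cmod (((mexp A - (1\<^sub>m n + A)) *\<^sub>v v) \<bullet>c u) \<le> K\<^sup>2 * vnorm v * vnorm u"
    by (simp add: mult.assoc)
qed

text \<open>Averaging exponentials and exponentiating the average agree to first order: both are 1 +
  L up to an error d^2, where L is the mean generator. Hence the factor 2.\<close>

lemma op_bound_avg_mexp:
  assumes I: "finite I" and p: "\<And>k. k \<in> I \<Longrightarrow> 0 \<le> p k" "(\<Sum>k\<in>I. p k) = (1::real)"
    and A: "\<And>k. k \<in> I \<Longrightarrow> op_bound n d (A k)" and d: "0 \<le> d" "d \<le> 1"
  shows "op_bound n (2 * d\<^sup>2)
    (sum_op n (\<lambda>k. complex_of_real (p k) \<cdot>\<^sub>m mexp (A k)) I -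
     mexp (sum_op n (\<lambda>k. complex_of_real (p k) \<cdot>\<^sub>m A k) I))"
    (is "op_bound _ _ (?W - mexp ?L)")
proof -
  have Ac [simp]: "A k \<in> carrier_mat n n" if "k \<in> I" for k using A[OF that] by auto
  have Lc: "?L \<in> carrier_mat n n" by (simp add: sum_op_def)
  let ?R = "\<lambda>k. complex_of_real (p k) \<cdot>\<^sub>m (mexp (A k) - (1\<^sub>m n + A k))"
  have "op_bound n (\<Sum>k\<in>I. cmod (complex_of_real (p k)) * d\<^sup>2) (sum_op n ?R I)"
    by (intro op_bound_sum_op op_bound_smult op_bound_mexp_remainder I A d)
  moreover have "(\<Sum>k\<in>I. cmod (complex_of_real (p k)) * d\<^sup>2) = d\<^sup>2"
    using p by (simp flip: sum_distrib_right)
  \<comment> \<open>The weights sum to one, so the identity and linear parts average exactly to 1 +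
    L.\<close>
  moreover have "sum_op n ?R I = ?W - (1\<^sub>m n + ?L)"
  proof (rule eq_matI)
    fix a b assume "a < dim_row (?W - (1\<^sub>m n + ?L))" "b < dim_col (?W - (1\<^sub>m n + ?L))"
    then have ab: "a < n" "b < n" by (auto simp: sum_op_def)
    have mc: "mexp (A k) \<in> carrier_mat n n" if "k \<in> I" for k using that by simp
    have "sum_op n ?R I $$ (a, b) =
        (\<Sum>k\<in>I. complex_of_real (p k) * (mexp (A k) $$ (a, b) - (1\<^sub>m n $$ (a, b) + A k $$ (a, b))))"
      using ab carrier_matD[OF Ac] carrier_matD[OF mc] by (auto simp: sum_op_def intro!: sum.cong)
    also have "\<dots> = (\<Sum>k\<in>I. complex_of_real (p k) * mexp (A k) $$ (a, b)) -
        (complex_of_real (\<Sum>k\<in>I. p k) * 1\<^sub>m n $$ (a, b) + (\<Sum>k\<in>I. complex_of_real (p k) * A k $$ (a, b)))"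
      by (simp only: ring_distribs sum_subtractf sum.distrib of_real_sum sum_distrib_right)
    also have "\<dots> = (?W - (1\<^sub>m n + ?L)) $$ (a, b)"
      using ab p(2) carrier_matD[OF Ac] carrier_matD[OF mc] by (auto simp: sum_op_def)
    finally show "sum_op n ?R I $$ (a, b) = (?W - (1\<^sub>m n + ?L)) $$ (a, b)" .
  qed (auto simp: sum_op_def)
  ultimately have W: "op_bound n (d\<^sup>2) (?W - (1\<^sub>m n + ?L))" by simp
  \<comment> \<open>L is a convex combination of generators bounded by d, so the remainder bound
    applies to it too.\<close>
  have "op_bound n (\<Sum>k\<in>I. cmod (complex_of_real (p k)) * d) ?L"
    by (intro op_bound_sum_op op_bound_smult I A)
  moreover have "(\<Sum>k\<in>I. cmod (complex_of_real (p k)) * d) = d"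
    using p by (simp flip: sum_distrib_right)
  ultimately have "op_bound n (d\<^sup>2) (mexp ?L - (1\<^sub>m n + ?L))"
    using d by (intro op_bound_mexp_remainder) auto
  from op_bound_diff[OF W this]
  have "op_bound n (2 * d\<^sup>2) ((?W - (1\<^sub>m n + ?L)) - (mexp ?L - (1\<^sub>m n + ?L)))" by simp
  also have "(?W - (1\<^sub>m n + ?L)) - (mexp ?L - (1\<^sub>m n + ?L)) = ?W - mexp ?L"
    using Lc by (intro eq_matI) (auto simp: sum_op_def mexp_def)
  finally show ?thesis .
qed

text \<open>Errors of contractions add up linearly: A^(N+1) - B^(N+1) = A^N (A - B) + (A^N - B^N) B,
  and the outer factors A^N and B do not amplify.\<close>

lemma op_bound_pow_diff:
  assumes A: "op_bound n 1 A" and B: "op_bound n 1 B" and AB: "op_bound n d (A - B)"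
    and d: "0 \<le> d"
  shows "op_bound n (real N * d) (A ^\<^sub>m N - B ^\<^sub>m N)"
proof (induction N)
  case 0
  have [simp]: "dim_row A = n" "dim_row B = n" using A B by auto
  have "op_bound n 0 (1\<^sub>m n - 1\<^sub>m n)"
    by (rule op_boundI_bracket) (auto simp: minus_r_inv_mat[of _ n n] bracket_sum[of "0\<^sub>m n n" n])
  then show ?case by simp
next
  case (Suc N)
  have [simp]: "A \<in> carrier_mat n n" "B \<in> carrier_mat n n" using A B by auto
  note [simp] = pow_carrier_mat[of A n] pow_carrier_mat[of B n]
  have telescope: "(X - Y) + (Y - Z) = X - Z"
    if "X \<in> carrier_mat n n" "Y \<in> carrier_mat n n" "Z \<in> carrier_mat n n" for X Y Z :: "complex mat"
    using that by (intro eq_matI) auto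
  have "op_bound n (1 ^ N * d + real N * d * 1) (A ^\<^sub>m N * (A - B) + (A ^\<^sub>m N - B ^\<^sub>m N) * B)"
    using d by (intro op_bound_add op_bound_mult op_bound_pow A B AB Suc) auto
  also have "A ^\<^sub>m N * (A - B) + (A ^\<^sub>m N - B ^\<^sub>m N) * B = A ^\<^sub>m Suc N - B ^\<^sub>m Suc N"
    by (simp add: mult_minus_distrib_mat[of _ n n _ n] minus_mult_distrib_mat[of _ n n _ _ n])
      (rule telescope; rule mult_carrier_mat[of _ n n _ n]; simp)
  finally show ?case by (simp add: algebra_simps)
qed

section \<open>Hermitian generators, unitarity, and the action on pure states\<close>

section \<open>Unitary evolutions\<close>

lemma mat_adjoint_entry:
  assumes "A \<in> carrier_mat n n" "a < n" "b < n"
  shows "mat_adjoint A $$ (a, b) = cnj (A $$ (b, a))"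
  using assms by (simp add: mat_adjoint_def mat_of_rows_def)

lemma hermitian_opD:
  assumes "hermitian_op n A"
  shows "A \<in> carrier_mat n n" and "a < n \<Longrightarrow> b < n \<Longrightarrow> A $$ (b, a) = cnj (A $$ (a, b))"
  using assms mat_adjoint_entry[of A n b a] by (simp_all add: hermitian_op_def)

lemma hermitian_opI:
  assumes A: "A \<in> carrier_mat n n"
    and sym: "\<And>a b. a < n \<Longrightarrow> b < n \<Longrightarrow> A $$ (b, a) = cnj (A $$ (a, b))"
  shows "hermitian_op n A"
proof -
  have "mat_adjoint A = A"
  proof (rule eq_matI)
    fix a b assume "a < dim_row A" "b < dim_col A"
    then show "mat_adjoint A $$ (a, b) = A $$ (a, b)"
      using A mat_adjoint_entry[OF A, of a b] sym[of b a] by (metis carrier_matD)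
  qed (simp_all add: mat_adjoint_def mat_of_rows_def carrier_matD[OF A])
  then show ?thesis using A by (simp add: hermitian_op_def)
qed

lemma hermitian_sum_op:
  assumes "\<And>k. k \<in> I \<Longrightarrow> hermitian_op n (H k)"
  shows "hermitian_op n (sum_op n H I)"
proof (rule hermitian_opI)
  fix a b assume ab: "a < n" "b < n"
  have "(\<Sum>k\<in>I. H k $$ (b, a)) = (\<Sum>k\<in>I. cnj (H k $$ (a, b)))"
    by (intro sum.cong refl hermitian_opD(2)[OF assms] ab)
  then show "sum_op n H I $$ (b, a) = cnj (sum_op n H I $$ (a, b))"
    using ab by (simp add: sum_op_def)
qed (simp add: sum_op_def)

lemma hermitian_pow_entry:
  assumes A: "hermitian_op n A" and ab: "a < n" "b < n"
  shows "(A ^\<^sub>m m) $$ (b, a) = cnj ((A ^\<^sub>m m) $$ (a, b))"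
  using ab
proof (induction m arbitrary: a b)
  case 0
  then show ?case using hermitian_opD(1)[OF A] by simp
next
  case (Suc m)
  note Ac = hermitian_opD(1)[OF A]
  note Am = pow_carrier_mat[OF Ac, of m]
  have "(A ^\<^sub>m Suc m) $$ (b, a) = (\<Sum>c<n. (A ^\<^sub>m m) $$ (b, c) * A $$ (c, a))"
    using mat_entry_mult[OF Am Ac] Suc.prems by simp
  also have "\<dots> = cnj (\<Sum>c<n. A $$ (a, c) * (A ^\<^sub>m m) $$ (c, b))"
    using Suc.prems by (simp add: Suc.IH[of _ b] hermitian_opD(2)[OF A, of a] mult.commute)
  \<comment> \<open>Taking adjoints reverses the product A^m A into A A^m; writing the exponent as 1
    + m lets \<open>pow_mat_add\<close> identify the two.\<close>
  also have "\<dots> = cnj ((A ^\<^sub>m (1 + m)) $$ (a, b))"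
    using mat_entry_mult[OF Ac Am Suc.prems] pow_mat_add[OF Ac, of 1 m] Ac by simp
  finally show ?case by simp
qed

lemma evolution_carrier [simp]: "A \<in> carrier_mat n n \<Longrightarrow> evolution A t \<in> carrier_mat n n"
  by (simp add: evolution_def)

lemma evolution_add:
  assumes "A \<in> carrier_mat n n"
  shows "evolution A s * evolution A t = evolution A (s + t)"
  using mexp_smult_add[OF assms, of "- \<i> * complex_of_real s" "- \<i> * complex_of_real t"]
  by (simp add: evolution_def ring_distribs)

lemma evolution_zero:
  assumes "A \<in> carrier_mat n n"
  shows "evolution A 0 = 1\<^sub>m n"
  using mexp_smult_zero[OF assms] by (simp add: evolution_def)

lemma evolution_pow:
  assumes A: "A \<in> carrier_mat n n"
  shows "evolution A t ^\<^sub>m N = evolution A (real N * t)"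
proof (induction N)
  case 0
  then show ?case using carrier_matD(1)[OF evolution_carrier[OF A]] by (simp add: evolution_zero[OF A])
next
  case (Suc N)
  then show ?case by (simp add: evolution_add[OF A] algebra_simps)
qed

text \<open>Conjugation is continuous and acts term by term: it flips the sign of the imaginary
  factor and transposes the Hermitian powers. Thus the backward evolution is the adjoint of the
  forward one.\<close>

lemma evolution_minus_entry:
  assumes A: "hermitian_op n A" and ab: "a < n" "b < n"
  shows "evolution A (- t) $$ (a, b) = cnj (evolution A t $$ (b, a))"
proof -
  note Ac = hermitian_opD(1)[OF A]
  have "(\<lambda>m. cnj ((((- \<i> * complex_of_real t) \<cdot>\<^sub>m A) ^\<^sub>m m) $$ (b, a) / fact m)) sums
      cnj (evolution A t $$ (b, a))"
    unfolding evolution_def using Ac ab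
    by (intro bounded_linear.sums[OF bounded_linear_cnj] mexp_entry_sums[of _ n]) auto
  moreover have "cnj ((((- \<i> * complex_of_real t) \<cdot>\<^sub>m A) ^\<^sub>m m) $$ (b, a) / fact m) =
      (((- \<i> * complex_of_real (- t)) \<cdot>\<^sub>m A) ^\<^sub>m m) $$ (a, b) / fact m" for m
    using ab Ac by (simp add: smult_pow_mat[OF Ac] pow_mat_dim hermitian_pow_entry[OF A, of a b])
  moreover have "(\<lambda>m. (((- \<i> * complex_of_real (- t)) \<cdot>\<^sub>m A) ^\<^sub>m m) $$ (a, b) / fact m) sums
      (evolution A (- t) $$ (a, b))"
    unfolding evolution_def using Ac ab by (intro mexp_entry_sums[of _ n]) auto
  ultimately show ?thesis using sums_unique2 by force
qed

text \<open>Moved to the other side of the bracket, the evolution becomes its backward version, and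
  the group law cancels the pair.\<close>

lemma vnorm_evolution:
  assumes A: "hermitian_op n A" and v: "v \<in> carrier_vec n"
  shows "vnorm (evolution A t *\<^sub>v v) = vnorm v"
proof -
  note Ac = hermitian_opD(1)[OF A]
  let ?U = "evolution A t"
  have U: "?U \<in> carrier_mat n n" using Ac by simp
  have Uv: "?U *\<^sub>v v \<in> carrier_vec n" using mult_mat_vec_carrier[OF U v] .
  have "(?U *\<^sub>v v) \<bullet>c (?U *\<^sub>v v) = (\<Sum>a<n. \<Sum>b<n. ?U $$ (a, b) * (v $ b * cnj ((?U *\<^sub>v v) $ a)))"
    by (rule bracket_sum[OF U v Uv])
  \<comment> \<open>The two slots of the bracket change places, which costs an outer conjugation; it
    disappears at the end because both brackets are real.\<close>
  also have "\<dots> = cnj (\<Sum>b<n. \<Sum>a<n. evolution A (- t) $$ (b, a) * ((?U *\<^sub>v v) $ a * cnj (v $ b)))"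
    by (subst sum.swap) (auto simp: evolution_minus_entry[OF A] mult_ac intro!: sum.cong)
  also have "\<dots> = cnj ((evolution A (- t) *\<^sub>v (?U *\<^sub>v v)) \<bullet>c v)"
    using Ac by (subst bracket_sum[OF _ Uv v]) auto
  also have "evolution A (- t) *\<^sub>v (?U *\<^sub>v v) = (evolution A (- t) * ?U) *\<^sub>v v"
    using Ac v by (subst assoc_mult_mat_vec[of _ n n _ n]) auto
  also have "\<dots> = v"
    using v by (simp add: evolution_add[OF Ac] evolution_zero[OF Ac])
  finally have "(vnorm (?U *\<^sub>v v))\<^sup>2 = (vnorm v)\<^sup>2"
    by (simp only: cscalar_prod_self complex_cnj_complex_of_real of_real_eq_iff)
  then show ?thesis by simp
qed

lemma op_bound_evolution: "hermitian_op n A \<Longrightarrow> op_bound n 1 (evolution A t)"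
  by (simp add: op_bound_def vnorm_evolution hermitian_opD(1))

text \<open>The right factor of the channel is the adjoint of the left one, so pure states stay
  pure. The error analysis can therefore follow vectors instead of density matrices.\<close>

lemma evolution_channel_ket_bra:
  assumes A: "hermitian_op n A" and v: "\<psi> \<in> carrier_vec n"
  shows "evolution_channel A t (ket_bra \<psi>) = ket_bra (evolution A t *\<^sub>v \<psi>)"
proof (rule eq_matI)
  have U: "evolution A s \<in> carrier_mat n n" for s using hermitian_opD(1)[OF A] by simp
  note dims = carrier_matD[OF U]
  have K: "ket_bra \<psi> \<in> carrier_mat n n" using v by (auto simp: ket_bra_def)
  have Uv: "(evolution A t *\<^sub>v \<psi>) $ a = (\<Sum>c<n. evolution A t $$ (a, c) * \<psi> $ c)" if "a < n" for a
    using that v dims by (auto simp: scalar_prod_def atLeast0LessThan intro!: sum.cong)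
  fix a b
  assume "a < dim_row (ket_bra (evolution A t *\<^sub>v \<psi>))" "b < dim_col (ket_bra (evolution A t *\<^sub>v \<psi>))"
  then have ab: "a < n" "b < n" using dims by (auto simp: ket_bra_def)
  have "evolution_channel A t (ket_bra \<psi>) $$ (a, b) =
      (\<Sum>d<n. (\<Sum>c<n. evolution A t $$ (a, c) * (\<psi> $ c * cnj (\<psi> $ d))) * cnj (evolution A t $$ (b, d)))"
    using ab v mat_entry_mult[OF mult_carrier_mat[OF U K] U ab] mat_entry_mult[OF U K]
    by (auto simp: evolution_channel_def evolution_minus_entry[OF A] ket_bra_def intro!: sum.cong)
  also have "\<dots> = (\<Sum>d<n. (\<Sum>c<n. evolution A t $$ (a, c) * \<psi> $ c) * cnj (evolution A t $$ (b, d) * \<psi> $ d))"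
    by (simp add: sum_distrib_left sum_distrib_right mult_ac)
  also have "\<dots> = ket_bra (evolution A t *\<^sub>v \<psi>) $$ (a, b)"
    using ab dims v
    by (simp add: ket_bra_def Uv flip: sum_distrib_left del: index_mult_mat_vec complex_cnj_mult)
  finally show "evolution_channel A t (ket_bra \<psi>) $$ (a, b) = ket_bra (evolution A t *\<^sub>v \<psi>) $$ (a, b)" .
qed (use hermitian_opD(1)[OF A] in \<open>auto simp: evolution_channel_def ket_bra_def evolution_def mexp_def\<close>)

lemma fold_mult_mat_vec_carrier:
  assumes "\<And>k. k \<in> set s \<Longrightarrow> V k \<in> carrier_mat n n" "\<psi> \<in> carrier_vec n"
  shows "fold (\<lambda>k. (*\<^sub>v) (V k)) s \<psi> \<in> carrier_vec n"
  using assms by (induction s arbitrary: \<psi>) (auto intro!: mult_mat_vec_carrier[of _ n n])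

text \<open>In the protocol the duration is a function of the index, so a list of indices determines
  the whole sequence.\<close>

lemma sequence_channel_ket_bra:
  assumes "\<And>k. k \<in> set s \<Longrightarrow> hermitian_op n (H k)" "\<psi> \<in> carrier_vec n"
  shows "sequence_channel H (map (\<lambda>k. (k, \<tau> k)) s) (ket_bra \<psi>) =
    ket_bra (fold (\<lambda>k. (*\<^sub>v) (evolution (H k) (\<tau> k))) s \<psi>)"
  using assms
proof (induction s arbitrary: \<psi>)
  case Nil
  then show ?case by (simp add: sequence_channel_def)
next
  case (Cons k s)
  have "evolution (H k) (\<tau> k) *\<^sub>v \<psi> \<in> carrier_vec n"
    using Cons.prems hermitian_opD(1) by (intro mult_mat_vec_carrier[of _ n n]) auto
  then show ?case
    using Cons.IH[of "evolution (H k) (\<tau> k) *\<^sub>v \<psi>"] Cons.prems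
    by (simp add: sequence_channel_def evolution_channel_ket_bra[where n = n])
qed

section \<open>Expectation of a product of independent random matrices\<close>

lemma finite_set_replicate_pmf: "finite (set_pmf q) \<Longrightarrow> finite (set_pmf (replicate_pmf N q))"
  using finite_lists_length_eq[of "set_pmf q" N]
  by (simp add: set_replicate_pmf in_lists_conv_set subset_eq)

text \<open>By independence the mean of the product is the power of the one-step mean. The first
  index acts on \<psi> first, so the induction conditions on it and \<psi> has to vary.\<close>

lemma expectation_fold_mult_mat_vec:
  fixes V :: "nat \<Rightarrow> complex mat"
  assumes I: "finite I" "set_pmf q \<subseteq> I" and V: "\<And>k. k \<in> I \<Longrightarrow> V k \<in> carrier_mat n n"
    and \<phi>: "\<phi> \<in> carrier_vec n" and \<psi>: "\<psi> \<in> carrier_vec n"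
  shows "(LINT s|replicate_pmf N q. fold (\<lambda>k. (*\<^sub>v) (V k)) s \<psi> \<bullet>c \<phi>) =
    ((sum_op n (\<lambda>k. complex_of_real (pmf q k) \<cdot>\<^sub>m V k) I ^\<^sub>m N) *\<^sub>v \<psi>) \<bullet>c \<phi>"
  (is "_ = ((?W ^\<^sub>m N) *\<^sub>v _) \<bullet>c _")
  using \<psi>
proof (induction N arbitrary: \<psi>)
  case 0
  then show ?case by (simp add: sum_op_def)
next
  case (Suc N)
  have W: "?W \<in> carrier_mat n n" by (simp add: sum_op_def)
  note WN = pow_carrier_mat[OF W, of N]
  have Vc: "V k *\<^sub>v \<psi> \<in> carrier_vec n" if "k \<in> I" for k
    using V[OF that] Suc.prems by simp
  have Wc: "?W *\<^sub>v \<psi> \<in> carrier_vec n" by (rule mult_mat_vec_carrier[OF W Suc.prems])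
  have fin: "finite (set_pmf q)" using I finite_subset by blast
  have "(LINT s|replicate_pmf (Suc N) q. fold (\<lambda>k. (*\<^sub>v) (V k)) s \<psi> \<bullet>c \<phi>) =
     (\<Sum>k\<in>I. pmf q k *\<^sub>R (LINT s|replicate_pmf N q. fold (\<lambda>k. (*\<^sub>v) (V k)) s (V k *\<^sub>v \<psi>) \<bullet>c \<phi>))"
    using I fin finite_set_replicate_pmf[OF fin]
    by (simp add: pmf_expectation_bind map_pmf_def[symmetric])
  also have "\<dots> = (\<Sum>k\<in>I. complex_of_real (pmf q k) * (((?W ^\<^sub>m N) *\<^sub>v (V k *\<^sub>v \<psi>)) \<bullet>c \<phi>))"
    by (intro sum.cong refl) (simp only: Suc.IH[OF Vc] scaleR_conv_of_real)
  \<comment> \<open>Expansion into entries exposes the linearity in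
    \<open>V k *\<^sub>v \<psi>\<close>, so the sum over k can move inside and form
    \<open>?W *\<^sub>v \<psi>\<close>.\<close>
  also have "\<dots> = (\<Sum>k\<in>I. \<Sum>a<n. \<Sum>b<n. (?W ^\<^sub>m N) $$ (a, b) *
      ((complex_of_real (pmf q k) * (V k *\<^sub>v \<psi>) $ b) * cnj (\<phi> $ a)))"
    by (intro sum.cong) (simp_all add: bracket_sum[OF WN Vc \<phi>] sum_distrib_left mult_ac
        del: index_mult_mat_vec)
  also have "\<dots> = (\<Sum>a<n. \<Sum>b<n. (?W ^\<^sub>m N) $$ (a, b) *
      ((\<Sum>k\<in>I. complex_of_real (pmf q k) * (V k *\<^sub>v \<psi>) $ b) * cnj (\<phi> $ a)))"
    by (simp add: sum_distrib_left sum_distrib_right sum.swap[of _ "{..<n}" I]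
        del: index_mult_mat_vec)
  also have "\<dots> = (\<Sum>a<n. \<Sum>b<n. (?W ^\<^sub>m N) $$ (a, b) * ((?W *\<^sub>v \<psi>) $ b * cnj (\<phi> $ a)))"
  proof -
    have "(\<Sum>k\<in>I. complex_of_real (pmf q k) * (V k *\<^sub>v \<psi>) $ b) = (?W *\<^sub>v \<psi>) $ b" if b: "b < n" for b
    proof -
      have "(\<Sum>k\<in>I. complex_of_real (pmf q k) * (V k *\<^sub>v \<psi>) $ b) =
          (\<Sum>k\<in>I. \<Sum>c<n. complex_of_real (pmf q k) * V k $$ (b, c) * \<psi> $ c)"
        using V b Suc.prems
        by (auto simp: scalar_prod_def atLeast0LessThan sum_distrib_left mult.assoc carrier_matD[OF V]
            intro!: sum.cong)
      also have "\<dots> = (?W *\<^sub>v \<psi>) $ b"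
        using b Suc.prems
        by (subst sum.swap) (auto simp: scalar_prod_def atLeast0LessThan sum_distrib_right
            sum_op_def carrier_matD[OF V] intro!: sum.cong)
      finally show ?thesis .
    qed
    then show ?thesis by simp
  qed
  also have "\<dots> = ((?W ^\<^sub>m N) *\<^sub>v (?W *\<^sub>v \<psi>)) \<bullet>c \<phi>"
    by (rule bracket_sum[OF WN Wc \<phi>, symmetric])
  also have "(?W ^\<^sub>m N) *\<^sub>v (?W *\<^sub>v \<psi>) = (?W ^\<^sub>m Suc N) *\<^sub>v \<psi>"
    using assoc_mult_mat_vec[OF WN W Suc.prems] by simp
  finally show ?case .
qed

section \<open>Fidelity of averaged channels and the sampling protocol\<close>

section \<open>Random product formulas\<close>

text \<open>The fidelity is the mean squared overlap. Its lower bound is affine in the overlap, so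
  only the mean overlap enters, and that is accessible through the mean operator.\<close>

lemma fidelity_averaged_channel_ge:
  fixes M :: "(nat \<times> real) list pmf"
  assumes fin: "finite (set_pmf M)"
    and chan: "\<And>s. s \<in> set_pmf M \<Longrightarrow> sequence_channel H s (ket_bra \<psi>) = ket_bra (\<chi> s)"
    and \<chi>: "\<And>s. s \<in> set_pmf M \<Longrightarrow> \<chi> s \<in> carrier_vec n"
    and \<phi>: "\<phi> \<in> carrier_vec n"
  shows "2 * Re (LINT s|M. \<chi> s \<bullet>c \<phi>) - 1 \<le> fidelity (ket_bra \<phi>) (averaged_channel n H M (ket_bra \<psi>))"
proof -
  define S where "S = set_pmf M"
  define \<rho> where "\<rho> = averaged_channel n H M (ket_bra \<psi>)"
  have S: "finite S" "(\<Sum>s\<in>S. pmf M s) = 1"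
    using fin by (auto simp: S_def sum_pmf_eq_1)
  have integral: "(LINT s|M. f s) = (\<Sum>s\<in>S. complex_of_real (pmf M s) * f s)" for f :: "_ \<Rightarrow> complex"
    using integral_measure_pmf[OF S(1), of M f] by (simp add: S_def scaleR_conv_of_real)
  have entry: "\<rho> $$ (a, b) = (\<Sum>s\<in>S. complex_of_real (pmf M s) * (\<chi> s $ a * cnj (\<chi> s $ b)))"
    if "a < n" "b < n" for a b
  proof -
    have "\<rho> $$ (a, b) = (\<Sum>s\<in>S. complex_of_real (pmf M s) * sequence_channel H s (ket_bra \<psi>) $$ (a, b))"
      using that by (simp add: \<rho>_def averaged_channel_def integral)
    also have "\<dots> = (\<Sum>s\<in>S. complex_of_real (pmf M s) * (ket_bra (\<chi> s) $$ (a, b)))"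
      by (intro sum.cong refl) (simp add: chan S_def)
    finally show ?thesis
      using that carrier_vecD[OF \<chi>] by (simp add: ket_bra_def S_def)
  qed
  have \<rho>: "\<rho> \<in> carrier_mat n n" by (simp add: \<rho>_def averaged_channel_def)
  have square: "(\<chi> s \<bullet>c \<phi>) * cnj (\<chi> s \<bullet>c \<phi>) =
      (\<Sum>a<n. \<Sum>b<n. (\<chi> s $ a * cnj (\<phi> $ a)) * cnj (\<chi> s $ b * cnj (\<phi> $ b)))" for s
    by (simp only: cscalar_prod_sum[OF carrier_vecD[OF \<phi>]] cnj_sum sum_product)
  have "(\<rho> *\<^sub>v \<phi>) \<bullet>c \<phi> = (\<Sum>a<n. \<Sum>b<n. \<Sum>s\<in>S. complex_of_real (pmf M s) *
      ((\<chi> s $ a * cnj (\<phi> $ a)) * cnj (\<chi> s $ b * cnj (\<phi> $ b))))"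
    unfolding bracket_sum[OF \<rho> \<phi> \<phi>] by (simp add: entry sum_distrib_left sum_distrib_right mult_ac)
  also have "\<dots> = (\<Sum>s\<in>S. complex_of_real (pmf M s) * ((\<chi> s \<bullet>c \<phi>) * cnj (\<chi> s \<bullet>c \<phi>)))"
    by (simp only: square sum_distrib_left sum.swap[of _ S "{..<n}"])
  also have "\<dots> = (\<Sum>s\<in>S. complex_of_real (pmf M s * (cmod (\<chi> s \<bullet>c \<phi>))\<^sup>2))"
    by (simp only: complex_norm_square of_real_mult)
  finally have "Re ((\<rho> *\<^sub>v \<phi>) \<bullet>c \<phi>) = (\<Sum>s\<in>S. pmf M s * (cmod (\<chi> s \<bullet>c \<phi>))\<^sup>2)"
    by simp
  also have "\<dots> \<ge> (\<Sum>s\<in>S. pmf M s * (2 * Re (\<chi> s \<bullet>c \<phi>) - 1))"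
  proof (intro sum_mono mult_left_mono)
    fix s
    \<comment> \<open>For the overlap z this expands to |z|^2 - 2 Re z + 1; equality holds at the
      ideal value z = 1.\<close>
    have "0 \<le> (Re (\<chi> s \<bullet>c \<phi>) - 1)\<^sup>2 + (Im (\<chi> s \<bullet>c \<phi>))\<^sup>2" by simp
    then show "2 * Re (\<chi> s \<bullet>c \<phi>) - 1 \<le> (cmod (\<chi> s \<bullet>c \<phi>))\<^sup>2"
      by (simp add: cmod_power2 power2_diff)
  qed simp
  finally have "(\<Sum>s\<in>S. pmf M s * (2 * Re (\<chi> s \<bullet>c \<phi>) - 1)) \<le> Re ((\<rho> *\<^sub>v \<phi>) \<bullet>c \<phi>)" .
  moreover have "(\<Sum>s\<in>S. pmf M s * (2 * Re (\<chi> s \<bullet>c \<phi>) - 1)) = 2 * Re (LINT s|M. \<chi> s \<bullet>c \<phi>) - 1"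
    using S(2) by (simp add: integral right_diff_distrib sum_subtractf sum_distrib_left mult_ac)
  ultimately show ?thesis
    using fidelity_ket_bra[OF \<rho> \<phi>] by (simp add: \<rho>_def)
qed

lemma exists_pmf_with_weights:
  fixes p :: "'a \<Rightarrow> real"
  assumes "finite I" "\<And>k. k \<in> I \<Longrightarrow> 0 \<le> p k" "sum p I = 1"
  obtains q where "set_pmf q \<subseteq> I" "\<And>k. k \<in> I \<Longrightarrow> pmf q k = p k"
proof -
  \<comment> \<open>Extension by zero gives a mass function on the whole type, the form required by
    \<open>embed_pmf\<close>.\<close>
  define f where "f k = (if k \<in> I then p k else 0)" for k
  have f: "0 \<le> f k" for k using assms(2) by (simp add: f_def)
  have "(\<integral>\<^sup>+ k. ennreal (f k) \<partial>count_space UNIV) = (\<Sum>k\<in>I. ennreal (f k))"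
    using assms(1) by (intro nn_integral_count_space') (auto simp: f_def)
  also have "\<dots> = ennreal (\<Sum>k\<in>I. f k)"
    using f by (intro sum_ennreal) auto
  also have "(\<Sum>k\<in>I. f k) = 1" using assms(3) by (simp add: f_def)
  finally have "(\<integral>\<^sup>+ k. ennreal (f k) \<partial>count_space UNIV) = 1" by simp
  note pmf = pmf_embed_pmf[OF f this] and set = set_embed_pmf[OF f this]
  show ?thesis
    by (rule that[of "embed_pmf f"]) (auto simp: pmf set f_def split: if_splits)
qed

text \<open>The step number N is left free, to be balanced against the accuracy later. The condition
  \<open>total_norm Q H * T \<le> real N\<close> puts the generators of a step in the range of the
  remainder bound.\<close>

lemma qdrift_simulates:
  assumes Q: "1 \<le> Q" and H: "\<And>k. k \<in> {1..Q} \<Longrightarrow> hermitian_op n (H k) \<and> H k \<noteq> 0\<^sub>m n n"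
    and T: "0 < T" and N: "0 < N" "total_norm Q H * T \<le> real N"
  obtains M :: "(nat \<times> real) list pmf"
  where "simulates n Q H T (4 * (total_norm Q H * T)\<^sup>2 / real N) M" "finite (set_pmf M)"
    "\<And>s. s \<in> set_pmf M \<Longrightarrow> length s = N \<and> (\<forall>(k, \<tau>)\<in>set s. k \<in> {1..Q} \<and> 0 < \<tau>)"
proof -
  define c where "c = total_norm Q H"
  \<comment> \<open>The common norm bound of all sampled generators \<open>\<tau> k\<close> times
    \<open>H k\<close>.\<close>
  define d where "d = c * T / real N"
  \<comment> \<open>Inversely proportional to the norm, which offsets sampling proportional to it:
    probability times duration is T / N for every k.\<close>
  define \<tau> where "\<tau> k = c * T / (real N * opnorm (H k))" for k
  define U where "U = evolution (sum_op n H {1..Q}) (T / real N)"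
  have herm: "hermitian_op n (H k)" and Hc: "H k \<in> carrier_mat n n" if "k \<in> {1..Q}" for k
    using H[OF that] hermitian_opD(1) by auto
  have Hs: "hermitian_op n (sum_op n H {1..Q})" by (intro hermitian_sum_op herm)
  have h: "0 < opnorm (H k)" if "k \<in> {1..Q}" for k
    using H[OF that] Hc[OF that] by (intro opnorm_pos) auto
  have c: "0 < c" unfolding c_def total_norm_def using Q h by (intro sum_pos) auto
  have d: "0 \<le> d" "d \<le> 1" using c T N by (auto simp: d_def c_def)
  have \<tau>: "0 < \<tau> k" if "k \<in> {1..Q}" for k
    using h[OF that] c T N by (simp add: \<tau>_def)
  have p0: "0 \<le> opnorm (H k) / c" if "k \<in> {1..Q}" for k
    using h[OF that] c by simp
  have p: "(\<Sum>k\<in>{1..Q}. opnorm (H k) / c) = 1"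
    using c by (simp add: c_def total_norm_def flip: sum_divide_distrib)
  obtain q where q: "set_pmf q \<subseteq> {1..Q}" "\<And>k. k \<in> {1..Q} \<Longrightarrow> pmf q k = opnorm (H k) / c"
    by (rule exists_pmf_with_weights[OF _ p0 p]) auto
  have pq: "(\<Sum>k\<in>{1..Q}. pmf q k) = 1"
    using p by (simp add: q(2))
  define W where "W = sum_op n (\<lambda>k. complex_of_real (pmf q k) \<cdot>\<^sub>m evolution (H k) (\<tau> k)) {1..Q}"
  have W1: "op_bound n 1 W"
  proof -
    have "op_bound n (\<Sum>k\<in>{1..Q}. cmod (complex_of_real (pmf q k)) * 1) W"
      unfolding W_def by (intro op_bound_sum_op op_bound_smult op_bound_evolution herm) auto
    then show ?thesis using pq by simp
  qed
  have U1: "op_bound n 1 U" unfolding U_def by (rule op_bound_evolution[OF Hs])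
  have WU: "op_bound n (2 * d\<^sup>2) (W - U)"
  proof -
    let ?A = "\<lambda>k. (- \<i> * complex_of_real (\<tau> k)) \<cdot>\<^sub>m H k"
    have A: "op_bound n d (?A k)" if "k \<in> {1..Q}" for k
    proof -
      have "cmod (- \<i> * complex_of_real (\<tau> k)) * opnorm (H k) = d"
        using \<tau>[OF that] h[OF that] by (simp add: norm_mult) (simp add: \<tau>_def d_def)
      then show ?thesis
        using op_bound_smult[OF op_bound_opnorm[OF Hc[OF that]], of "- \<i> * complex_of_real (\<tau> k)"]
        by simp
    qed
    have "complex_of_real (pmf q k) * (- \<i> * complex_of_real (\<tau> k)) = - \<i> * complex_of_real (T / real N)"
      if "k \<in> {1..Q}" for k
    proof -
      have "pmf q k * \<tau> k = T / real N"
        using h[OF that] c by (simp add: q(2)[OF that] \<tau>_def)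
      then show ?thesis by (metis mult.left_commute of_real_mult)
    qed
    \<comment> \<open>The mean generator of one step is exactly that of the true evolution for time
      T / N.\<close>
    then have avg: "sum_op n (\<lambda>k. complex_of_real (pmf q k) \<cdot>\<^sub>m ?A k) {1..Q} =
        (- \<i> * complex_of_real (T / real N)) \<cdot>\<^sub>m sum_op n H {1..Q}"
      using carrier_matD[OF Hc]
      by (intro eq_matI) (auto simp: sum_op_def sum_distrib_left simp flip: mult.assoc intro!: sum.cong)
    have "op_bound n (2 * d\<^sup>2) (W - mexp (sum_op n (\<lambda>k. complex_of_real (pmf q k) \<cdot>\<^sub>m ?A k) {1..Q}))"
      unfolding W_def evolution_def by (intro op_bound_avg_mexp A d pq) auto
    then show ?thesis
      unfolding avg U_def evolution_def .
  qed
  have UN: "U ^\<^sub>m N = evolution (sum_op n H {1..Q}) T"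
    unfolding U_def evolution_pow[OF hermitian_opD(1)[OF Hs]] using N by simp
  have WUN: "op_bound n (real N * (2 * d\<^sup>2)) (W ^\<^sub>m N - U ^\<^sub>m N)"
    by (intro op_bound_pow_diff W1 U1 WU) simp
  define M where "M = map_pmf (map (\<lambda>k. (k, \<tau> k))) (replicate_pmf N q)"
  have fin: "finite (set_pmf M)"
    unfolding M_def using finite_set_replicate_pmf[OF finite_subset[OF q(1)]] by simp
  have set: "\<exists>l. s = map (\<lambda>k. (k, \<tau> k)) l \<and> length l = N \<and> set l \<subseteq> {1..Q}" if "s \<in> set_pmf M" for s
    using that q(1) by (auto simp: M_def set_replicate_pmf in_lists_conv_set)
  have supp: "length s = N \<and> (\<forall>(k, t)\<in>set s. k \<in> {1..Q} \<and> 0 < t)" if "s \<in> set_pmf M" for s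
    using set[OF that] \<tau> by (auto simp: subset_eq)
  have re: "random_evolutions n Q H M"
    unfolding random_evolutions_def
    using supp fin by (auto simp: AE_measure_pmf_iff measure_pmf.prob_space_axioms
        intro: integrable_measure_pmf_finite)
  have "1 - 4 * (c * T)\<^sup>2 / real N \<le>
      fidelity (evolution_channel (sum_op n H {1..Q}) T (ket_bra \<psi>)) (averaged_channel n H M (ket_bra \<psi>))"
    if \<psi>: "pure_state n \<psi>" for \<psi>
  proof -
    have \<psi>c: "\<psi> \<in> carrier_vec n" and \<psi>1: "vnorm \<psi> = 1" using \<psi> by (auto simp: pure_state_def)
    define \<phi> where "\<phi> = evolution (sum_op n H {1..Q}) T *\<^sub>v \<psi>"
    have UNc: "U ^\<^sub>m N \<in> carrier_mat n n" and WNc: "W ^\<^sub>m N \<in> carrier_mat n n"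
      using U1 W1 by (auto intro: pow_carrier_mat)
    have \<phi>: "\<phi> \<in> carrier_vec n" "vnorm \<phi> = 1"
      using mult_mat_vec_carrier[OF UNc \<psi>c] vnorm_evolution[OF Hs \<psi>c] \<psi>1 by (auto simp: \<phi>_def UN)
    \<comment> \<open>Projecting to the indices makes the output vector a function of the sampled
      sequence; on the support this recovers the list that was drawn.\<close>
    define \<chi> where "\<chi> s = fold (\<lambda>k. (*\<^sub>v) (evolution (H k) (\<tau> k))) (map fst s) \<psi>" for s :: "(nat \<times> real) list"
    have chan: "sequence_channel H s (ket_bra \<psi>) = ket_bra (\<chi> s)"
      and \<chi>c: "\<chi> s \<in> carrier_vec n" if s: "s \<in> set_pmf M" for s
    proof -
      obtain l where l: "s = map (\<lambda>k. (k, \<tau> k)) l" "set l \<subseteq> {1..Q}" using set[OF s] by blast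
      have "\<chi> s = fold (\<lambda>k. (*\<^sub>v) (evolution (H k) (\<tau> k))) l \<psi>"
        by (simp add: \<chi>_def l(1) comp_def)
      then show "sequence_channel H s (ket_bra \<psi>) = ket_bra (\<chi> s)" "\<chi> s \<in> carrier_vec n"
        using l \<psi>c herm Hc
        by (auto simp: l(1) subset_eq intro!: sequence_channel_ket_bra[of _ n] fold_mult_mat_vec_carrier)
    qed
    have "(LINT s|M. \<chi> s \<bullet>c \<phi>) = (W ^\<^sub>m N *\<^sub>v \<psi>) \<bullet>c \<phi>"
      unfolding M_def W_def integral_map_pmf \<chi>_def
      using expectation_fold_mult_mat_vec[of "{1..Q}" q "\<lambda>k. evolution (H k) (\<tau> k)" n \<phi> \<psi> N] q(1) Hc \<phi>(1) \<psi>c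
      by (simp add: comp_def)
    \<comment> \<open>The exact evolution is subtracted and added back; its bracket with \<phi> is
      the squared norm of \<phi>, namely 1.\<close>
    also have "\<dots> = ((W ^\<^sub>m N - U ^\<^sub>m N) *\<^sub>v \<psi>) \<bullet>c \<phi> + 1"
    proof -
      have "(U ^\<^sub>m N *\<^sub>v \<psi>) \<bullet>c \<phi> = 1"
        unfolding UN \<phi>_def[symmetric] cscalar_prod_self \<phi>(2) by simp
      moreover have "((W ^\<^sub>m N - U ^\<^sub>m N) *\<^sub>v \<psi>) \<bullet>c \<phi> = (W ^\<^sub>m N *\<^sub>v \<psi>) \<bullet>c \<phi> - (U ^\<^sub>m N *\<^sub>v \<psi>) \<bullet>c \<phi>"
        unfolding minus_mult_distrib_mat_vec[OF WNc UNc \<psi>c]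
        by (rule minus_scalar_prod_distrib[of _ n])
          (use mult_mat_vec_carrier[OF WNc \<psi>c] mult_mat_vec_carrier[OF UNc \<psi>c] \<phi>(1) in auto)
      ultimately show ?thesis by simp
    qed
    finally have E: "Re (LINT s|M. \<chi> s \<bullet>c \<phi>) = Re (((W ^\<^sub>m N - U ^\<^sub>m N) *\<^sub>v \<psi>) \<bullet>c \<phi>) + 1" by simp
    have "cmod (((W ^\<^sub>m N - U ^\<^sub>m N) *\<^sub>v \<psi>) \<bullet>c \<phi>) \<le> real N * (2 * d\<^sup>2)"
      using op_bound_bracket[OF WUN \<psi>c \<phi>(1)] \<psi>1 \<phi>(2) by simp
    then have "1 - real N * (2 * d\<^sup>2) \<le> Re (LINT s|M. \<chi> s \<bullet>c \<phi>)"
      using abs_Re_le_cmod[of "((W ^\<^sub>m N - U ^\<^sub>m N) *\<^sub>v \<psi>) \<bullet>c \<phi>"] by (simp add: E)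
    \<comment> \<open>The outer 2 comes from linearising the fidelity, the inner one from the two
      remainders in a step.\<close>
    moreover have "2 * (real N * (2 * d\<^sup>2)) = 4 * (c * T)\<^sup>2 / real N"
      using N by (simp add: d_def power2_eq_square)
    ultimately have "1 - 4 * (c * T)\<^sup>2 / real N \<le> 2 * Re (LINT s|M. \<chi> s \<bullet>c \<phi>) - 1"
      by linarith
    also have "\<dots> \<le> fidelity (ket_bra \<phi>) (averaged_channel n H M (ket_bra \<psi>))"
      by (rule fidelity_averaged_channel_ge[OF fin chan \<chi>c \<phi>(1)])
    also have "ket_bra \<phi> = evolution_channel (sum_op n H {1..Q}) T (ket_bra \<psi>)"
      unfolding \<phi>_def by (rule evolution_channel_ket_bra[OF Hs \<psi>c, symmetric])
    finally show ?thesis .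
  qed
  with re have "simulates n Q H T (4 * (total_norm Q H * T)\<^sup>2 / real N) M"
    by (simp add: simulates_def c_def)
  from this fin supp show ?thesis by (rule that)
qed

section \<open>Choice of the step number and the resulting gate count\<close>

theorem mainTheorem2:
  fixes g :: nat
  shows "\<exists>(C::real) (p::nat) (x\<^sub>0::real).
    \<forall>(n::nat) (Q::nat) (H :: nat \<Rightarrow> complex mat) (gates :: nat \<Rightarrow> real \<Rightarrow> nat) (T::real) (\<epsilon>\<^sub>0::real) (x::real).
      1 \<le> Q \<longrightarrow>
      (\<forall>k\<in>{1..Q}. hermitian_op n (H k) \<and> H k \<noteq> 0\<^sub>m n n) \<longrightarrow>
      (\<forall>k\<in>{1..Q}. \<forall>\<tau>>0. gates k \<tau> \<le> g) \<longrightarrow>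
      0 < T \<longrightarrow> 0 < \<epsilon>\<^sub>0 \<longrightarrow> \<epsilon>\<^sub>0 < 1 \<longrightarrow>
      x = (total_norm Q H)\<^sup>2 * T\<^sup>2 / \<epsilon>\<^sub>0 \<longrightarrow> x\<^sub>0 \<le> x \<longrightarrow>
      (\<exists>M. simulates n Q H T \<epsilon>\<^sub>0 M \<and>
           integrable M (\<lambda>s. real (gate_count gates s)) \<and>
           (LINT s|M. real (gate_count gates s)) \<le> C * (x * ln x ^ p))"
\<comment> \<open>The protocol takes at most 5 x steps of at most g gates. With exponent 0 the
  logarithmic factor is 1, also at x = 1, and the threshold 1 absorbs the rounding of the step
  number.\<close>
proof (rule exI[of _ "5 * real g"], rule exI[of _ 0], rule exI[of _ 1], intro allI impI)
  fix n Q :: nat and H :: "nat \<Rightarrow> complex mat" and gates :: "nat \<Rightarrow> real \<Rightarrow> nat" and T \<epsilon>\<^sub>0 x :: real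
  assume Q: "1 \<le> Q" and H: "\<forall>k\<in>{1..Q}. hermitian_op n (H k) \<and> H k \<noteq> 0\<^sub>m n n"
    and gates: "\<forall>k\<in>{1..Q}. \<forall>\<tau>>0. gates k \<tau> \<le> g"
    and T: "0 < T" and \<epsilon>: "0 < \<epsilon>\<^sub>0" "\<epsilon>\<^sub>0 < 1"
    and x: "x = (total_norm Q H)\<^sup>2 * T\<^sup>2 / \<epsilon>\<^sub>0" "1 \<le> x"
  \<comment> \<open>The factor 4 cancels that of the error bound, leaving \<epsilon>; the ceiling
    adds at most 1, hence at most x.\<close>
  define N where "N = nat \<lceil>4 * x\<rceil>"
  have N: "4 * x \<le> real N" "real N \<le> 5 * x"
    using x(2) unfolding N_def by linarith+
  have cT: "(total_norm Q H * T)\<^sup>2 = x * \<epsilon>\<^sub>0"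
    using \<epsilon> by (simp add: x(1) power_mult_distrib)
  \<comment> \<open>Since the accuracy is below 1 \<le> x, this yields cT \<le> x and so the
    smallness of a step required by \<open>qdrift_simulates\<close>.\<close>
  also have "\<dots> \<le> x\<^sup>2"
    using \<epsilon> x(2) by (simp add: power2_eq_square mult_left_mono)
  finally have "total_norm Q H * T \<le> x"
    by (rule power2_le_imp_le) (use x(2) in simp)
  then have "total_norm Q H * T \<le> real N" "0 < N" using N x(2) by linarith+
  then obtain M :: "(nat \<times> real) list pmf"
    where M: "simulates n Q H T (4 * (total_norm Q H * T)\<^sup>2 / real N) M" "finite (set_pmf M)"
      "\<And>s. s \<in> set_pmf M \<Longrightarrow> length s = N \<and> (\<forall>(k, \<tau>)\<in>set s. k \<in> {1..Q} \<and> 0 < \<tau>)"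
    using qdrift_simulates[OF Q _ T] H by metis
  have "4 * (x * \<epsilon>\<^sub>0) \<le> \<epsilon>\<^sub>0 * real N"
    using mult_right_mono[OF N(1), of \<epsilon>\<^sub>0] \<epsilon> by (simp add: mult_ac)
  then have "4 * (total_norm Q H * T)\<^sup>2 / real N \<le> \<epsilon>\<^sub>0"
    using \<open>0 < N\<close> by (simp add: cT divide_le_eq)
  with M(1) have sim: "simulates n Q H T \<epsilon>\<^sub>0 M"
    unfolding simulates_def by force
  \<comment> \<open>The length is deterministic and all durations are positive, so the gate bound
    holds for each sampled sequence, and then for the mean.\<close>
  have "gate_count gates s \<le> N * g" if "s \<in> set_pmf M" for s
  proof -
    have "(\<Sum>(k, \<tau>)\<leftarrow>s. gates k \<tau>) \<le> (\<Sum>_\<leftarrow>s. g)"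
      using M(3)[OF that] gates by (intro sum_list_mono) auto
    then show ?thesis using M(3)[OF that] by (simp add: gate_count_def sum_list_triv)
  qed
  then have "(LINT s|M. real (gate_count gates s)) \<le> (LINT s|M. real (N * g))"
    using M(2) by (intro integral_mono_AE integrable_measure_pmf_finite)
      (auto simp: AE_measure_pmf_iff simp flip: of_nat_mult)
  also have "\<dots> \<le> 5 * real g * (x * ln x ^ 0)"
    using mult_right_mono[OF N(2), of "real g"] by (simp add: mult_ac)
  finally show "\<exists>M. simulates n Q H T \<epsilon>\<^sub>0 M \<and> integrable M (\<lambda>s. real (gate_count gates s)) \<and>
      (LINT s|M. real (gate_count gates s)) \<le> 5 * real g * (x * ln x ^ 0)"
    using sim integrable_measure_pmf_finite[OF M(2)] by blast
qed

end
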